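(* Let $\kappa$ be an infinite cardinal, let $\mathcal K=[\kappa]^{<\kappa}=\{Z\subseteq\kappa\mid |Z|<\kappa\}$, and let $x<\kappa$. For $y<\kappa$ put $\mathcal U_{\ge y}=\{A\subseteq\kappa\mid A\ne\emptyset,\ \min A=y\}$. Then: (i) the subballean of $\exp(\kappa_{\mathcal K})$ with support $\mathcal U_{\ge x}$ is asymorphic to $\mathbb C(\kappa,\mathcal K)$; so $\exp^\ast(\kappa_{\mathcal K})$ is the disjoint union of $\kappa$ pairwise close copies of $\mathbb C(\kappa,\mathcal K)$ (namely of the sets $\mathcal U_{\ge y}$, $y<\kappa$); (ii) if $\kappa$ is regular, then $\exp(\kappa_{\mathcal K})$ asymorphically embeds into $\exp(\kappa_{\mathcal K\text{-}ary})$.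
   Context: A ballean is a triple $\mathcal B=(X,P,B)$ where $X$ (the support) and $P\neq\emptyset$ (the radii set) are sets and $B\colon X\times P\to\mathcal P(X)$ is a map such that: $x\in B(x,\alpha)$ for all $x,\alpha$; $x\in B(y,\alpha)$ iff $y\in B(x,\alpha)$; for all $\alpha,\beta\in P$ there is $\gamma\in P$ with $B(B(x,\alpha),\beta)\subseteq B(x,\gamma)$ for all $x\in X$, where $B(A,\delta)=\bigcup_{y\in A}B(y,\delta)$. The subballean on $Y\subseteq X$ is $(Y,P,B_Y)$ with $B_Y(y,\alpha)=B(y,\alpha)\cap Y$. The connected component of $x\in X$ is $\bigcup_{\alpha\in P}B(x,\alpha)$. A map $f\colon X\to Y$ between balleans $(X,P_X,B_X)$, $(Y,P_Y,B_Y)$ is coarse if for every $\alpha\in P_X$ there is $\beta\in P_Y$ with $f(B_X(x,\alpha))\subseteq B_Y(f(x),\beta)$ for all $x\in X$. It is an asymorphism if it is bijective and both $f$ and $f^{-1}$ are coarse; two balleans are asymorphic if there is an asymorphism between them. An asymorphic embedding is a map that is an asymorphism onto its image (with the subballean structure). The hyperballean of $\mathcal B=(X,P,B)$ is $\exp(\mathcal B)=(\mathcal P(X),P,\exp B)$, with $\exp B(A,\alpha)=\{C\in\mathcal P(X)\mid A\subseteq B(C,\alpha),\ C\subseteq B(A,\alpha)\}$; $\exp^\ast(\mathcal B)$ is its subballean on $\mathcal P(X)\setminus\{\emptyset\}$. Two subsets of the support of a ballean $\mathcal B$ are called close if they lie in the same connected component of $\exp\mathcal B$. (Thus in (i), "pairwise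 close" refers to the $\mathcal U_{\ge y}$ as subsets of the support of the ballean $\exp^\ast(\kappa_{\mathcal K})$.) For an ideal $\mathcal I$ on a set $X$ (closed under finite unions and subsets, $X\notin\mathcal I$, containing all finite subsets): the $\mathcal I$-ary ballean $X_{\mathcal I\text{-}ary}=(X,\mathcal I,B_{\mathcal I\text{-}ary})$ has balls $B_{\mathcal I\text{-}ary}(x,A)=\{x\}\cup A$; the point ideal ballean $X_{\mathcal I}=(X,\mathcal I,B_{\mathcal I})$ has balls $B_{\mathcal I}(x,A)=\{x\}$ if $x\notin A$ and $B_{\mathcal I}(x,A)=A$ if $x\in A$; the ballean $\mathbb C(X,\mathcal I)$ has support $\mathcal P(X)$ (identified with $\{0,1\}^X$), radii set $\mathcal I$ and balls $B_{\mathbb C}(A,K)=\{Y\subseteq X\mid A\setminus K\subseteq Y\subseteq A\cup K\}$. Here these are used with $X=\kappa$, $\mathcal I=\mathcal K$. *)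

theory Defs
  imports Main "HOL-Library.Disjoint_Sets"
begin

unbundle cardinal_syntax

section \<open>Balleans\<close>

record ('x, 'p) ball_structure =
  support :: "'x set"
  radii :: "'p set"
  ball :: "'x \<Rightarrow> 'p \<Rightarrow> 'x set"

definition ball_set :: "('x, 'p) ball_structure \<Rightarrow> 'x set \<Rightarrow> 'p \<Rightarrow> 'x set" where
  "ball_set B A \<alpha> = (\<Union>y\<in>A. ball B y \<alpha>)"

definition ballean :: "('x, 'p) ball_structure \<Rightarrow> bool" where
  "ballean B \<longleftrightarrow>
     radii B \<noteq> {} \<and>
     (\<forall>x\<in>support B. \<forall>\<alpha>\<in>radii B. ball B x \<alpha> \<subseteq> support B) \<and>
     (\<forall>x\<in>support B. \<forall>\<alpha>\<in>radii B. x \<in> ball B x \<alpha>) \<and>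
     (\<forall>x\<in>support B. \<forall>y\<in>support B. \<forall>\<alpha>\<in>radii B. x \<in> ball B y \<alpha> \<longleftrightarrow> y \<in> ball B x \<alpha>) \<and>
     (\<forall>\<alpha>\<in>radii B. \<forall>\<beta>\<in>radii B. \<exists>\<gamma>\<in>radii B. \<forall>x\<in>support B.
        ball_set B (ball B x \<alpha>) \<beta> \<subseteq> ball B x \<gamma>)"

definition subballean :: "('x, 'p) ball_structure \<Rightarrow> 'x set \<Rightarrow> ('x, 'p) ball_structure" where
  "subballean B Y = \<lparr>support = Y, radii = radii B, ball = (\<lambda>y \<alpha>. ball B y \<alpha> \<inter> Y)\<rparr>"

definition component :: "('x, 'p) ball_structure \<Rightarrow> 'x \<Rightarrow> 'x set" where
  "component B x = (\<Union>\<alpha>\<in>radii B. ball B x \<alpha>)"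

definition coarse_map ::
  "('x, 'p) ball_structure \<Rightarrow> ('y, 'q) ball_structure \<Rightarrow> ('x \<Rightarrow> 'y) \<Rightarrow> bool" where
  "coarse_map B C f \<longleftrightarrow>
     f ` support B \<subseteq> support C \<and>
     (\<forall>\<alpha>\<in>radii B. \<exists>\<beta>\<in>radii C. \<forall>x\<in>support B. f ` ball B x \<alpha> \<subseteq> ball C (f x) \<beta>)"

definition asymorphism ::
  "('x, 'p) ball_structure \<Rightarrow> ('y, 'q) ball_structure \<Rightarrow> ('x \<Rightarrow> 'y) \<Rightarrow> bool" where
  "asymorphism B C f \<longleftrightarrow>
     bij_betw f (support B) (support C) \<and>
     coarse_map B C f \<and> coarse_map C B (inv_into (support B) f)"

definition asymorphic :: "('x, 'p) ball_structure \<Rightarrow> ('y, 'q) ball_structure \<Rightarrow> bool" where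
  "asymorphic B C \<longleftrightarrow> (\<exists>f. asymorphism B C f)"

definition asymorphic_embedding ::
  "('x, 'p) ball_structure \<Rightarrow> ('y, 'q) ball_structure \<Rightarrow> ('x \<Rightarrow> 'y) \<Rightarrow> bool" where
  "asymorphic_embedding B C f \<longleftrightarrow>
     f ` support B \<subseteq> support C \<and> asymorphism B (subballean C (f ` support B)) f"

section \<open>Hyperballeans\<close>

definition hyperballean :: "('x, 'p) ball_structure \<Rightarrow> ('x set, 'p) ball_structure" where
  "hyperballean B =
     \<lparr>support = Pow (support B), radii = radii B,
      ball = (\<lambda>A \<alpha>. {C \<in> Pow (support B). A \<subseteq> ball_set B C \<alpha> \<and> C \<subseteq> ball_set B A \<alpha>})\<rparr>"

definition hyperballean_ne :: "('x, 'p) ball_structure \<Rightarrow> ('x set, 'p) ball_structure" where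
  "hyperballean_ne B = subballean (hyperballean B) (Pow (support B) - {{}})"

definition close_sets :: "('x, 'p) ball_structure \<Rightarrow> 'x set \<Rightarrow> 'x set \<Rightarrow> bool" where
  "close_sets B A C \<longleftrightarrow>
     (\<exists>D\<in>support (hyperballean B).
        A \<in> component (hyperballean B) D \<and> C \<in> component (hyperballean B) D)"

section \<open>Balleans of an ideal\<close>

definition set_ideal :: "'a set \<Rightarrow> 'a set set \<Rightarrow> bool" where
  "set_ideal X I \<longleftrightarrow>
     I \<subseteq> Pow X \<and> X \<notin> I \<and>
     (\<forall>F. finite F \<and> F \<subseteq> X \<longrightarrow> F \<in> I) \<and>
     (\<forall>A\<in>I. \<forall>C. C \<subseteq> A \<longrightarrow> C \<in> I) \<and>
     (\<forall>A\<in>I. \<forall>C\<in>I. A \<union> C \<in> I)"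

definition ary_ballean :: "'a set \<Rightarrow> 'a set set \<Rightarrow> ('a, 'a set) ball_structure" where
  "ary_ballean X I = \<lparr>support = X, radii = I, ball = (\<lambda>x A. {x} \<union> A)\<rparr>"

definition point_ideal_ballean :: "'a set \<Rightarrow> 'a set set \<Rightarrow> ('a, 'a set) ball_structure" where
  "point_ideal_ballean X I =
     \<lparr>support = X, radii = I, ball = (\<lambda>x A. if x \<in> A then A else {x})\<rparr>"

definition cantor_ballean :: "'a set \<Rightarrow> 'a set set \<Rightarrow> ('a set, 'a set) ball_structure" where
  "cantor_ballean X I =
     \<lparr>support = Pow X, radii = I,
      ball = (\<lambda>A K. {Y. Y \<subseteq> X \<and> A - K \<subseteq> Y \<and> Y \<subseteq> A \<union> K})\<rparr>"

section \<open>The ideal of small subsets of a cardinal\<close>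

text \<open>A cardinal \<open>\<kappa>\<close> is a cardinal well-order \<open>r\<close>: the elements of \<open>Field r\<close> play the role of
  the ordinals below \<open>\<kappa>\<close>, and \<open>r\<close> is their (reflexive) order.\<close>

definition small_subsets :: "'a rel \<Rightarrow> 'a set set" where
  "small_subsets r = {Z. Z \<subseteq> Field r \<and> |Z| <o r}"

definition sets_with_min :: "'a rel \<Rightarrow> 'a \<Rightarrow> 'a set set" where
  "sets_with_min r y = {A. A \<subseteq> Field r \<and> A \<noteq> {} \<and> wo_rel.minim r A = y}"

section \<open>Well-definedness\<close>

lemma balleanI:
  assumes "radii B \<noteq> {}"
    and "\<And>x y \<alpha>. x \<in> support B \<Longrightarrow> \<alpha> \<in> radii B \<Longrightarrow> y \<in> ball B x \<alpha> \<Longrightarrow> y \<in> support B"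
    and "\<And>x \<alpha>. x \<in> support B \<Longrightarrow> \<alpha> \<in> radii B \<Longrightarrow> x \<in> ball B x \<alpha>"
    and "\<And>x y \<alpha>. x \<in> support B \<Longrightarrow> y \<in> support B \<Longrightarrow> \<alpha> \<in> radii B \<Longrightarrow>
           x \<in> ball B y \<alpha> \<Longrightarrow> y \<in> ball B x \<alpha>"
    and "\<And>\<alpha> \<beta>. \<alpha> \<in> radii B \<Longrightarrow> \<beta> \<in> radii B \<Longrightarrow> \<exists>\<gamma>\<in>radii B. \<forall>x\<in>support B.
           \<forall>y\<in>ball B x \<alpha>. \<forall>z\<in>ball B y \<beta>. z \<in> ball B x \<gamma>"
  shows "ballean B"
  unfolding ballean_def
proof (intro conjI ballI)
  fix \<alpha> \<beta> assume "\<alpha> \<in> radii B" "\<beta> \<in> radii B"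
  from assms(5)[OF this] obtain \<gamma> where "\<gamma> \<in> radii B"
    "\<forall>x\<in>support B. \<forall>y\<in>ball B x \<alpha>. \<forall>z\<in>ball B y \<beta>. z \<in> ball B x \<gamma>" ..
  then show "\<exists>\<gamma>\<in>radii B. \<forall>x\<in>support B. ball_set B (ball B x \<alpha>) \<beta> \<subseteq> ball B x \<gamma>"
    unfolding ball_set_def by (intro bexI[of _ \<gamma>]) auto
qed (use assms(1) in blast, use assms(2) in blast, use assms(3) in blast, use assms(4) in blast)

lemma ballean_subballean:
  assumes "ballean B" and "Y \<subseteq> support B"
  shows "ballean (subballean B Y)"
proof (rule balleanI; simp add: subballean_def)
  show "radii B \<noteq> {}" using assms unfolding ballean_def by blast
  show "x \<in> ball B x \<alpha>" if "x \<in> Y" "\<alpha> \<in> radii B" for x \<alpha>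
    using that assms unfolding ballean_def by blast
  show "y \<in> ball B x \<alpha>" if "x \<in> Y" "y \<in> Y" "\<alpha> \<in> radii B" "x \<in> ball B y \<alpha>" for x y \<alpha>
    using that assms unfolding ballean_def by blast
  fix \<alpha> \<beta> assume "\<alpha> \<in> radii B" "\<beta> \<in> radii B"
  then obtain \<gamma> where "\<gamma> \<in> radii B"
    and "\<forall>x\<in>support B. ball_set B (ball B x \<alpha>) \<beta> \<subseteq> ball B x \<gamma>"
    using assms(1) unfolding ballean_def by blast
  then show "\<exists>\<gamma>\<in>radii B. \<forall>x\<in>Y. \<forall>y\<in>ball B x \<alpha> \<inter> Y. \<forall>z\<in>ball B y \<beta> \<inter> Y. z \<in> ball B x \<gamma>"
    using assms(2) unfolding ball_set_def by blast
qed

lemma ballean_hyperballean: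
  assumes "ballean B"
  shows "ballean (hyperballean B)"
proof -
  let ?H = "hyperballean B"
  have simps: "support ?H = Pow (support B)" "radii ?H = radii B"
    "\<And>A \<alpha>. ball ?H A \<alpha> = {C \<in> Pow (support B). A \<subseteq> ball_set B C \<alpha> \<and> C \<subseteq> ball_set B A \<alpha>}"
    by (simp_all add: hyperballean_def)
  have refl: "A \<subseteq> ball_set B A \<alpha>" if "A \<subseteq> support B" "\<alpha> \<in> radii B" for A \<alpha>
  proof
    fix x assume "x \<in> A"
    moreover from this have "x \<in> ball B x \<alpha>" using assms that unfolding ballean_def by blast
    ultimately show "x \<in> ball_set B A \<alpha>" unfolding ball_set_def by (rule UN_I)
  qed
  have comp: "\<exists>\<gamma>\<in>radii B. \<forall>A. A \<subseteq> support B \<longrightarrow>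
      ball_set B (ball_set B A \<alpha>) \<beta> \<subseteq> ball_set B A \<gamma>"
    if ab: "\<alpha> \<in> radii B" "\<beta> \<in> radii B" for \<alpha> \<beta>
  proof -
    from assms ab obtain \<gamma> where "\<gamma> \<in> radii B"
      and g: "\<forall>x\<in>support B. ball_set B (ball B x \<alpha>) \<beta> \<subseteq> ball B x \<gamma>"
      unfolding ballean_def by blast
    moreover have "ball_set B (ball_set B A \<alpha>) \<beta> \<subseteq> ball_set B A \<gamma>" if "A \<subseteq> support B" for A
    proof
      fix z assume "z \<in> ball_set B (ball_set B A \<alpha>) \<beta>"
      then obtain x where x: "x \<in> A" "z \<in> ball_set B (ball B x \<alpha>) \<beta>"
        unfolding ball_set_def by auto
      then have "z \<in> ball B x \<gamma>" using g that by auto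
      with x(1) show "z \<in> ball_set B A \<gamma>" unfolding ball_set_def by (rule UN_I)
    qed
    ultimately show ?thesis by blast
  qed
  have mono: "ball_set B A \<alpha> \<subseteq> ball_set B A' \<alpha>" if "A \<subseteq> A'" for A A' \<alpha>
    unfolding ball_set_def using that by (rule UN_mono) (rule subset_refl)
  have tri: "\<exists>\<gamma>\<in>radii B. \<forall>A C D. A \<subseteq> support B \<longrightarrow> D \<subseteq> support B \<longrightarrow>
      A \<subseteq> ball_set B C \<alpha> \<longrightarrow> C \<subseteq> ball_set B A \<alpha> \<longrightarrow>
      C \<subseteq> ball_set B D \<beta> \<longrightarrow> D \<subseteq> ball_set B C \<beta> \<longrightarrow>
      A \<subseteq> ball_set B D \<gamma> \<and> D \<subseteq> ball_set B A \<gamma>"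
    if ab: "\<alpha> \<in> radii B" "\<beta> \<in> radii B" for \<alpha> \<beta>
  proof -
    from comp[OF ab] obtain \<gamma>1 where g1: "\<gamma>1 \<in> radii B" "\<forall>A. A \<subseteq> support B \<longrightarrow>
        ball_set B (ball_set B A \<alpha>) \<beta> \<subseteq> ball_set B A \<gamma>1" ..
    from comp[OF ab(2,1)] obtain \<gamma>2 where g2: "\<gamma>2 \<in> radii B" "\<forall>A. A \<subseteq> support B \<longrightarrow>
        ball_set B (ball_set B A \<beta>) \<alpha> \<subseteq> ball_set B A \<gamma>2" ..
    from comp[OF g1(1) g2(1)] obtain \<gamma> where g: "\<gamma> \<in> radii B" "\<forall>A. A \<subseteq> support B \<longrightarrow>
        ball_set B (ball_set B A \<gamma>1) \<gamma>2 \<subseteq> ball_set B A \<gamma>" ..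
    have "\<forall>x\<in>support B. ball B x \<gamma>1 \<subseteq> support B"
      using assms g1(1) by (simp add: ballean_def)
    then have inb: "ball_set B A \<gamma>1 \<subseteq> support B" if "A \<subseteq> support B" for A
      using that unfolding ball_set_def by auto
    have s1: "ball_set B A \<gamma>1 \<subseteq> ball_set B A \<gamma>" if "A \<subseteq> support B" for A
      using refl[OF inb[OF that] g2(1)] g(2)[rule_format, OF that] by (rule subset_trans)
    have s2: "ball_set B A \<gamma>2 \<subseteq> ball_set B A \<gamma>" if "A \<subseteq> support B" for A
      using mono[OF refl[OF that g1(1)], of \<gamma>2] g(2)[rule_format, OF that] by (rule subset_trans)
    show ?thesis
    proof (intro bexI[of _ \<gamma>] allI impI g(1))
      fix A C D
      assume h: "A \<subseteq> support B" "D \<subseteq> support B" "A \<subseteq> ball_set B C \<alpha>" "C \<subseteq> ball_set B A \<alpha>"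
        "C \<subseteq> ball_set B D \<beta>" "D \<subseteq> ball_set B C \<beta>"
      have "A \<subseteq> ball_set B D \<gamma>"
        using h(3) mono[OF h(5), of \<alpha>] g2(2)[rule_format, OF h(2)] s2[OF h(2)] by (meson subset_trans)
      moreover have "D \<subseteq> ball_set B A \<gamma>"
        using h(6) mono[OF h(4), of \<beta>] g1(2)[rule_format, OF h(1)] s1[OF h(1)] by (meson subset_trans)
      ultimately show "A \<subseteq> ball_set B D \<gamma> \<and> D \<subseteq> ball_set B A \<gamma>" ..
    qed
  qed
  show ?thesis
  proof (rule balleanI; unfold simps)
    show "radii B \<noteq> {}" using assms unfolding ballean_def by blast
  next
    fix A \<alpha> assume "A \<in> Pow (support B)" "\<alpha> \<in> radii B"
    then show "A \<in> {C \<in> Pow (support B). A \<subseteq> ball_set B C \<alpha> \<and> C \<subseteq> ball_set B A \<alpha>}"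
      using refl[of A \<alpha>] by simp
  next
    fix \<alpha> \<beta> assume ab: "\<alpha> \<in> radii B" "\<beta> \<in> radii B"
    from tri[OF ab] obtain \<gamma> where gam: "\<gamma> \<in> radii B" and
      g: "\<forall>A C D. A \<subseteq> support B \<longrightarrow> D \<subseteq> support B \<longrightarrow>
        A \<subseteq> ball_set B C \<alpha> \<longrightarrow> C \<subseteq> ball_set B A \<alpha> \<longrightarrow>
        C \<subseteq> ball_set B D \<beta> \<longrightarrow> D \<subseteq> ball_set B C \<beta> \<longrightarrow>
        A \<subseteq> ball_set B D \<gamma> \<and> D \<subseteq> ball_set B A \<gamma>" ..
    show "\<exists>\<gamma>\<in>radii B. \<forall>A\<in>Pow (support B).
        \<forall>C\<in>{C \<in> Pow (support B). A \<subseteq> ball_set B C \<alpha> \<and> C \<subseteq> ball_set B A \<alpha>}.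
        \<forall>D\<in>{D \<in> Pow (support B). C \<subseteq> ball_set B D \<beta> \<and> D \<subseteq> ball_set B C \<beta>}.
        D \<in> {D \<in> Pow (support B). A \<subseteq> ball_set B D \<gamma> \<and> D \<subseteq> ball_set B A \<gamma>}"
    proof (intro bexI[of _ \<gamma>] ballI gam)
      fix A C D
      assume "A \<in> Pow (support B)"
        "C \<in> {C \<in> Pow (support B). A \<subseteq> ball_set B C \<alpha> \<and> C \<subseteq> ball_set B A \<alpha>}"
        "D \<in> {D \<in> Pow (support B). C \<subseteq> ball_set B D \<beta> \<and> D \<subseteq> ball_set B C \<beta>}"
      then show "D \<in> {D \<in> Pow (support B). A \<subseteq> ball_set B D \<gamma> \<and> D \<subseteq> ball_set B A \<gamma>}"
        using g[rule_format, of A D C] by simp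
    qed
  qed simp_all
qed

lemma ballean_hyperballean_ne:
  "ballean B \<Longrightarrow> ballean (hyperballean_ne B)"
  unfolding hyperballean_ne_def
  by (rule ballean_subballean[OF ballean_hyperballean]) (auto simp: hyperballean_def)

lemma ballean_point_ideal:
  assumes "set_ideal X I"
  shows "ballean (point_ideal_ballean X I)"
proof (rule balleanI)
  fix \<alpha> \<beta> assume "\<alpha> \<in> radii (point_ideal_ballean X I)" "\<beta> \<in> radii (point_ideal_ballean X I)"
  then have "\<alpha> \<union> \<beta> \<in> I" using assms by (auto simp: set_ideal_def point_ideal_ballean_def)
  then show "\<exists>\<gamma>\<in>radii (point_ideal_ballean X I). \<forall>x\<in>support (point_ideal_ballean X I).
      \<forall>y\<in>ball (point_ideal_ballean X I) x \<alpha>. \<forall>z\<in>ball (point_ideal_ballean X I) y \<beta>.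
      z \<in> ball (point_ideal_ballean X I) x \<gamma>"
    by (intro bexI[of _ "\<alpha> \<union> \<beta>"]) (auto simp: point_ideal_ballean_def split: if_splits)
qed (use assms in \<open>auto simp: point_ideal_ballean_def set_ideal_def split: if_splits\<close>)

lemma ballean_cantor:
  assumes "set_ideal X I"
  shows "ballean (cantor_ballean X I)"
proof (rule balleanI)
  fix \<alpha> \<beta> assume "\<alpha> \<in> radii (cantor_ballean X I)" "\<beta> \<in> radii (cantor_ballean X I)"
  then have "\<alpha> \<union> \<beta> \<in> I" using assms by (auto simp: set_ideal_def cantor_ballean_def)
  then show "\<exists>\<gamma>\<in>radii (cantor_ballean X I). \<forall>x\<in>support (cantor_ballean X I).
      \<forall>y\<in>ball (cantor_ballean X I) x \<alpha>. \<forall>z\<in>ball (cantor_ballean X I) y \<beta>.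
      z \<in> ball (cantor_ballean X I) x \<gamma>"
    by (intro bexI[of _ "\<alpha> \<union> \<beta>"]) (auto simp: cantor_ballean_def)
qed (use assms in \<open>auto simp: cantor_ballean_def set_ideal_def\<close>)

text \<open>\<open>ary_ballean X I\<close> itself is not symmetric: for \<open>y \<in> A\<close> and \<open>x \<in> X - A\<close> one has \<open>y \<in> {x} \<union> A\<close> but \<open>x \<notin> {y} \<union> A\<close>. Its hyperballean is nevertheless a ballean, since
  the definition of the hyperballean symmetrizes the balls.\<close>

lemma ballean_hyperballean_ary:
  assumes "set_ideal X I"
  shows "ballean (hyperballean (ary_ballean X I))"
proof -
  let ?H = "hyperballean (ary_ballean X I)"
  have bs: "ball_set (ary_ballean X I) A K = (if A = {} then {} else A \<union> K)" for A K
    by (auto simp: ball_set_def ary_ballean_def)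
  have ball: "ball ?H A K =
      {C. C \<subseteq> X \<and> A \<subseteq> C \<union> K \<and> C \<subseteq> A \<union> K \<and> (A = {} \<longleftrightarrow> C = {})}" for A K
    unfolding hyperballean_def ball_structure.simps bs by (auto simp: ary_ballean_def)
  have simps: "support ?H = Pow X" "radii ?H = I"
    by (simp_all add: hyperballean_def ary_ballean_def)
  show ?thesis
  proof (rule balleanI; unfold simps ball)
    show "I \<noteq> {}" using assms unfolding set_ideal_def by blast
    fix \<alpha> \<beta> assume "\<alpha> \<in> I" "\<beta> \<in> I"
    then have "\<alpha> \<union> \<beta> \<in> I" using assms by (auto simp: set_ideal_def)
    then show "\<exists>\<gamma>\<in>I. \<forall>A\<in>Pow X.
        \<forall>C\<in>{C. C \<subseteq> X \<and> A \<subseteq> C \<union> \<alpha> \<and> C \<subseteq> A \<union> \<alpha> \<and> (A = {} \<longleftrightarrow> C = {})}.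
        \<forall>D\<in>{D. D \<subseteq> X \<and> C \<subseteq> D \<union> \<beta> \<and> D \<subseteq> C \<union> \<beta> \<and> (C = {} \<longleftrightarrow> D = {})}.
        D \<in> {D. D \<subseteq> X \<and> A \<subseteq> D \<union> \<gamma> \<and> D \<subseteq> A \<union> \<gamma> \<and> (A = {} \<longleftrightarrow> D = {})}"
      by (intro bexI[of _ "\<alpha> \<union> \<beta>"] ballI) (simp_all, blast)
  qed auto
qed

lemma set_ideal_small_subsets:
  assumes "Cinfinite r"
  shows "set_ideal (Field r) (small_subsets r)"
proof -
  have inf: "\<not> finite (Field r)" and card: "Card_order r"
    using assms by (auto simp: cinfinite_def)
  have "\<not> |Field r| <o r"
    using card card_of_Field_ordIso not_ordLess_ordIso by blast
  moreover have "|F| <o r" if "finite F" for F :: "'a set"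
    using that assms by (intro Cfinite_ordLess_Cinfinite) (simp_all add: cfinite_def Field_card_of card_of_card_order_on)
  moreover have "|C| <o r" if "|A| <o r" "C \<subseteq> A" for A C :: "'a set"
    using that card_of_mono1 ordLeq_ordLess_trans by blast
  moreover have "|A \<union> C| <o r" if "|A| <o r" "|C| <o r" for A C :: "'a set"
    using card_of_Un_ordLess_infinite_Field[OF inf card that] .
  ultimately show ?thesis
    unfolding set_ideal_def small_subsets_def by blast
qed

end

theory Submission
  imports Defs
begin

text \<open>
  In the hyperballean of a point ideal ballean, two distinct sets are \<open>K\<close>-near iff both meet \<open>K\<close>
  and they agree off \<open>K\<close>. Among the sets with least element \<open>y\<close> the first condition is harmless
  (put \<open>y\<close> into \<open>K\<close>), so deleting \<open>y\<close> and identifying the elements above \<open>y\<close> with the whole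
  cardinal gives (i). For (ii), split the cardinal into two copies of itself and send \<open>A\<close> to the
  union of \<open>A\<close> in the first copy and of the initial segment below \<open>min A\<close> in the second one.
  Since small sets are bounded in a regular cardinal, the second part detects whether the
  minimum of \<open>A\<close> escapes a given small set, that is, whether \<open>A\<close> meets an initial segment.
\<close>

section \<open>Balls and asymorphisms\<close>

text \<open>Both coarseness conditions are put in terms of \<open>f\<close> alone, so that
  \<open>inv_into\<close> never appears in later proofs. Containment of balls in the supports is
  assumed because the record type does not enforce it.\<close>

lemma asymorphismI:
  assumes "bij_betw f (support B) (support C)"
    and "\<And>x \<alpha>. x \<in> support B \<Longrightarrow> \<alpha> \<in> radii B \<Longrightarrow> ball B x \<alpha> \<subseteq> support B"
    and "\<And>y \<beta>. y \<in> support C \<Longrightarrow> \<beta> \<in> radii C \<Longrightarrow> ball C y \<beta> \<subseteq> support C"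
    and "\<And>\<alpha>. \<alpha> \<in> radii B \<Longrightarrow> \<exists>\<beta>\<in>radii C. \<forall>x\<in>support B. \<forall>y\<in>support B.
           y \<in> ball B x \<alpha> \<longrightarrow> f y \<in> ball C (f x) \<beta>"
    and "\<And>\<beta>. \<beta> \<in> radii C \<Longrightarrow> \<exists>\<alpha>\<in>radii B. \<forall>x\<in>support B. \<forall>y\<in>support B.
           f y \<in> ball C (f x) \<beta> \<longrightarrow> y \<in> ball B x \<alpha>"
  shows "asymorphism B C f"
proof -
  let ?g = "inv_into (support B) f"
  have g: "?g u \<in> support B" "f (?g u) = u" if "u \<in> support C" for u
    using assms(1) that by (metis bij_betw_def inv_into_into, metis bij_betw_inv_into_right)
  have "coarse_map B C f"
    unfolding coarse_map_def
  proof (intro conjI ballI)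
    show "f ` support B \<subseteq> support C" using assms(1) by (simp add: bij_betw_def)
    fix \<alpha> assume \<alpha>: "\<alpha> \<in> radii B"
    with assms(4) obtain \<beta> where "\<beta> \<in> radii C"
      "\<forall>x\<in>support B. \<forall>y\<in>support B. y \<in> ball B x \<alpha> \<longrightarrow> f y \<in> ball C (f x) \<beta>" by blast
    with assms(2)[OF _ \<alpha>] show "\<exists>\<beta>\<in>radii C. \<forall>x\<in>support B. f ` ball B x \<alpha> \<subseteq> ball C (f x) \<beta>"
      by blast
  qed
  moreover have "coarse_map C B ?g"
    unfolding coarse_map_def
  proof (intro conjI ballI)
    show "?g ` support C \<subseteq> support B" using g by blast
    fix \<beta> assume \<beta>: "\<beta> \<in> radii C"
    with assms(5) obtain \<alpha> where \<alpha>: "\<alpha> \<in> radii B"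
      "\<forall>x\<in>support B. \<forall>y\<in>support B. f y \<in> ball C (f x) \<beta> \<longrightarrow> y \<in> ball B x \<alpha>" by blast
    have "?g v \<in> ball B (?g u) \<alpha>" if "u \<in> support C" "v \<in> ball C u \<beta>" for u v
    proof -
      have "v \<in> support C" using assms(3)[OF that(1) \<beta>] that(2) by blast
      with that g[of u] g[of v] \<alpha>(2) show ?thesis by simp
    qed
    with \<alpha>(1) show "\<exists>\<alpha>\<in>radii B. \<forall>u\<in>support C. ?g ` ball C u \<beta> \<subseteq> ball B (?g u) \<alpha>"
      by blast
  qed
  ultimately show ?thesis using assms(1) by (simp add: asymorphism_def)
qed

lemma hyperballean_simps [simp]:
  "support (hyperballean B) = Pow (support B)" "radii (hyperballean B) = radii B"
  by (simp_all add: hyperballean_def)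

lemma subballean_simps [simp]:
  "support (subballean B Y) = Y" "radii (subballean B Y) = radii B"
  "ball (subballean B Y) y \<alpha> = ball B y \<alpha> \<inter> Y"
  by (simp_all add: subballean_def)

lemma subballean_subballean:
  "Z \<subseteq> Y \<Longrightarrow> subballean (subballean B Y) Z = subballean B Z"
  by (auto simp: subballean_def fun_eq_iff)

lemma point_ideal_ballean_simps [simp]:
  "support (point_ideal_ballean X I) = X" "radii (point_ideal_ballean X I) = I"
  by (simp_all add: point_ideal_ballean_def)

lemma ary_ballean_simps [simp]:
  "support (ary_ballean X I) = X" "radii (ary_ballean X I) = I"
  by (simp_all add: ary_ballean_def)

lemma cantor_ballean_simps [simp]:
  "support (cantor_ballean X I) = Pow X" "radii (cantor_ballean X I) = I"
  by (simp_all add: cantor_ballean_def)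

lemma mem_ball_cantor_iff:
  "C \<in> ball (cantor_ballean X I) A K \<longleftrightarrow> C \<subseteq> X \<and> A - K = C - K"
  by (auto simp: cantor_ballean_def)

text \<open>A nonempty set swells to \<open>A \<union> K\<close> and the empty set to nothing. So
  the empty set is isolated, and nonempty sets are compared off \<open>K\<close> as in the Cantor
  ballean.\<close>

lemma mem_ball_exp_ary_iff:
  "C \<in> ball (hyperballean (ary_ballean X I)) A K \<longleftrightarrow>
     C \<subseteq> X \<and> (A = {} \<longleftrightarrow> C = {}) \<and> A - K = C - K"
proof -
  have "ball_set (ary_ballean X I) A K = (if A = {} then {} else A \<union> K)" for A
    by (auto simp: ball_set_def ary_ballean_def)
  then show ?thesis by (auto simp: hyperballean_def)
qed

text \<open>A radius enlarges a set only if the set meets it. If \<open>A\<close> or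
  \<open>C\<close> misses \<open>K\<close>, the mutual inclusions force the other to miss it too,
  and then \<open>A = C\<close>.\<close>

lemma mem_ball_exp_point_ideal_iff:
  "C \<in> ball (hyperballean (point_ideal_ballean X I)) A K \<longleftrightarrow>
     C \<subseteq> X \<and> (A = C \<or> A \<inter> K \<noteq> {} \<and> C \<inter> K \<noteq> {} \<and> A - K = C - K)"
proof -
  have "ball_set (point_ideal_ballean X I) A K = (if A \<inter> K = {} then A else A \<union> K)" for A
    by (auto simp: ball_set_def point_ideal_ballean_def split: if_splits)
  then show ?thesis by (simp add: hyperballean_def) blast
qed

section \<open>Infinite cardinal orders\<close>

lemma sets_with_min_eq:
  assumes "wo_rel r"
  shows "sets_with_min r y = {A. A \<subseteq> Field r \<and> y \<in> A \<and> (\<forall>a\<in>A. (y, a) \<in> r)}"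
proof -
  interpret wo_rel r by (rule assms)
  have "minim A = y \<longleftrightarrow> y \<in> A \<and> (\<forall>a\<in>A. (y, a) \<in> r)" if "A \<subseteq> Field r" "A \<noteq> {}" for A
    using minim_in[OF that] minim_least[OF that(1)] equals_minim[OF that(1)] by metis
  then show ?thesis unfolding sets_with_min_def by blast
qed

lemma Cinfinite_wo_rel: "Cinfinite r \<Longrightarrow> wo_rel r"
  by (simp add: card_order_on_def wo_rel_def)

lemma small_subset_Un:
  assumes "Cinfinite r" "K \<in> small_subsets r" "L \<in> small_subsets r"
  shows "K \<union> L \<in> small_subsets r"
  using set_ideal_small_subsets[OF assms(1)] assms(2,3) by (simp add: set_ideal_def)

lemma small_subset_mono:
  assumes "Cinfinite r" "K \<in> small_subsets r" "L \<subseteq> K"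
  shows "L \<in> small_subsets r"
  using set_ideal_small_subsets[OF assms(1)] assms(2,3) by (simp add: set_ideal_def)

lemma small_subset_under:
  assumes "Cinfinite r" and "x \<in> Field r"
  shows "under r x \<in> small_subsets r"
proof -
  have "under r x = underS r x \<union> {x}"
    using assms by (simp add: Refl_under_underS wo_rel.REFL Cinfinite_wo_rel)
  moreover have "underS r x \<in> small_subsets r"
    using assms card_of_underS by (auto simp: small_subsets_def underS_Field)
  moreover have "{x} \<in> small_subsets r"
    using assms set_ideal_small_subsets by (force simp: set_ideal_def)
  ultimately show ?thesis
    using small_subset_Un[OF assms(1)] by metis
qed

lemma small_subset_image:
  assumes "K \<in> small_subsets r" and "f ` K \<subseteq> Field r"
  shows "f ` K \<in> small_subsets r"
  using assms card_of_image[of f K] ordLeq_ordLess_trans by (auto simp: small_subsets_def)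

text \<open>Cofinal sets in a regular cardinal have full cardinality, so a small \<open>K\<close>
  leaves some \<open>b\<close> with no member of \<open>K\<close> strictly above it.\<close>

lemma small_subset_bounded:
  assumes "Cinfinite r" "regularCard r" "K \<in> small_subsets r"
  obtains a where "a \<in> Field r" "K \<subseteq> underS r a"
proof -
  interpret wo_rel r using assms(1) by (rule Cinfinite_wo_rel)
  have "\<not> cofinal K r"
    using assms(2,3) not_ordLess_ordIso unfolding regularCard_def small_subsets_def by blast
  then obtain b where b: "b \<in> Field r" "\<forall>k\<in>K. b \<noteq> k \<longrightarrow> (b, k) \<notin> r"
    unfolding cofinal_def by blast
  \<comment> \<open>\<open>b\<close> may itself lie in \<open>K\<close>; an infinite cardinal has no
    greatest element, and a larger \<open>a\<close> makes the bound strict.\<close>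
  from infinite_Card_order_limit[OF _ _ b(1)] assms(1) obtain a
    where a: "a \<in> Field r" "b \<noteq> a" "(b, a) \<in> r" by (auto simp: cinfinite_def)
  have "k \<in> underS a" if "k \<in> K" for k
  proof -
    have "(k, b) \<in> r"
      using b that assms(3) TOTALS REFL by (force simp: small_subsets_def refl_on_def)
    moreover have "(a, b) \<notin> r" using a ANTISYM by (auto dest: antisymD)
    ultimately show ?thesis using a(3) TRANS by (auto simp: underS_def dest: transD)
  qed
  with a(1) that show ?thesis by blast
qed

text \<open>The elements above \<open>y\<close> complement the small segment
  \<open>under r y\<close>. If they were small too, so would be the whole field; hence they have
  full cardinality.\<close>

lemma Cinfinite_above_bij:
  assumes "Cinfinite r" and "y \<in> Field r"
  obtains g where "bij_betw g (aboveS r y) (Field r)"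
proof -
  interpret wo_rel r using assms(1) by (rule Cinfinite_wo_rel)
  have split: "aboveS y = Field r - under y"
    using assms(2) TOTALS ANTISYM REFL
    by (auto simp: aboveS_def under_def antisym_def refl_on_def FieldI2 dest: FieldI2)
  have "under y \<union> (Field r - under y) = Field r" using under_Field[of r y] by blast
  then have "Field r - under y \<notin> small_subsets r"
    using small_subset_Un[OF assms(1) small_subset_under[OF assms]] set_ideal_small_subsets[OF assms(1)]
    by (metis set_ideal_def)
  then have "r \<le>o |Field r - under y|"
    using assms(1) not_ordLess_iff_ordLeq[of r "|Field r - under y|"]
      card_of_Well_order[of "Field r - under y"]
    by (auto simp: small_subsets_def card_order_on_def)
  moreover have "|Field r| =o r" using assms(1) card_of_Field_ordIso by blast
  ultimately have "|Field r| \<le>o |Field r - under y|"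
    using ordIso_ordLeq_trans by blast
  then have "|aboveS y| =o |Field r|"
    unfolding split by (simp add: ordIso_iff_ordLeq card_of_mono1)
  with that show ?thesis by (auto simp: card_of_ordIso[symmetric])
qed

section \<open>Sets with a prescribed minimum\<close>

lemma asymorphic_sets_with_min:
  assumes r: "Cinfinite r" and y: "y \<in> Field r"
  shows "asymorphic
    (subballean (hyperballean (point_ideal_ballean (Field r) (small_subsets r))) (sets_with_min r y))
    (cantor_ballean (Field r) (small_subsets r))"
proof -
  interpret wo_rel r using r by (rule Cinfinite_wo_rel)
  obtain g where g: "bij_betw g (aboveS y) (Field r)"
    using Cinfinite_above_bij[OF assms] .
  let ?U = "sets_with_min r y" and ?I = "small_subsets r"
  let ?f = "\<lambda>A. g ` (A - {y})"
  let ?h = "inv_into (aboveS y) g"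
  have U: "A \<in> ?U \<longleftrightarrow> y \<in> A \<and> A - {y} \<subseteq> aboveS y" for A
    using y REFL by (auto simp: sets_with_min_eq[OF wo_rel_axioms] aboveS_def refl_on_def FieldI2)
  have inj: "inj_on g (aboveS y)" and im: "g ` aboveS y = Field r"
    using g by (auto simp: bij_betw_def)
  have ideal: "set_ideal (Field r) ?I" by (rule set_ideal_small_subsets[OF r])
  have bij: "bij_betw ?f ?U (Pow (Field r))"
  proof (rule bij_betw_imageI)
    show "inj_on ?f ?U"
    proof (rule inj_onI)
      fix A C assume "A \<in> ?U" "C \<in> ?U" "?f A = ?f C"
      then have "A - {y} = C - {y}" "y \<in> A" "y \<in> C"
        using inj by (auto simp: U inj_on_image_eq_iff)
      then show "A = C" by blast
    qed
    show "?f ` ?U = Pow (Field r)"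
    proof (intro equalityI subsetI)
      fix D assume "D \<in> Pow (Field r)"
      then obtain E where "E \<subseteq> aboveS y" "D = g ` E" using im by (metis PowD subset_imageE)
      moreover have "y \<notin> aboveS y" by (simp add: aboveS_def)
      ultimately show "D \<in> ?f ` ?U"
        by (intro image_eqI[of _ _ "insert y E"]) (auto simp: U)
    qed (use im in \<open>force simp: U\<close>)
  qed
  show ?thesis
    unfolding asymorphic_def
  proof (rule exI[of _ ?f], rule asymorphismI, goal_cases)
    case 1
    show ?case using bij by simp
  next
    case (4 K)
    then have K: "K \<in> ?I" by simp
    \<comment> \<open>\<open>g\<close> is controlled only on \<open>aboveS y\<close>. The point
      \<open>y\<close> lost by this restriction lies in both sets and is removed by
      \<open>?f\<close> anyway.\<close>
    have "K \<inter> aboveS y \<in> ?I" by (rule small_subset_mono[OF r K]) simp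
    then have "g ` (K \<inter> aboveS y) \<in> ?I" by (rule small_subset_image) (use im in auto)
    moreover have "?f C \<in> ball (cantor_ballean (Field r) ?I) (?f A) (g ` (K \<inter> aboveS y))"
      if "A \<in> ?U" "C \<in> ?U"
        "C \<in> ball (hyperballean (point_ideal_ballean (Field r) ?I)) A K" for A C
      using that inj im
      by (simp add: mem_ball_exp_point_ideal_iff mem_ball_cantor_iff U) blast
    ultimately show ?case by auto
  next
    case (5 K)
    then have K: "K \<in> ?I" by simp
    \<comment> \<open>With \<open>y\<close> inserted, every member of \<open>?U\<close> meets the
      radius, as point ideal balls demand of distinct sets; the rest pulls \<open>K\<close> back
      along \<open>g\<close>.\<close>
    let ?K = "insert y (?h ` K)"
    have KF: "K \<subseteq> Field r" using K by (simp add: small_subsets_def)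
    have "?h ` K \<subseteq> aboveS y" using KF im inv_into_into[of _ g "aboveS y"] by blast
    also have "\<dots> \<subseteq> Field r" by (auto simp: aboveS_def FieldI2)
    finally have "?h ` K \<in> ?I" by (rule small_subset_image[OF K])
    moreover have "{y} \<in> ?I" using ideal y by (simp add: set_ideal_def)
    ultimately have "?K \<in> ?I" using small_subset_Un[OF r, of "{y}"] by simp
    moreover have "C \<in> ball (hyperballean (point_ideal_ballean (Field r) ?I)) A ?K"
      if AC: "A \<in> ?U" "C \<in> ?U" "?f A - K = ?f C - K" for A C
    proof -
      \<comment> \<open>Stated for fresh \<open>A\<close> and \<open>C\<close>, so that swapping
        them yields the other inclusion.\<close>
      have "a \<in> C" if "a \<in> A - ?K" "A \<in> ?U" "C \<in> ?U" "?f A - K = ?f C - K" for a A C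
      proof -
        have a: "a \<in> aboveS y" using that by (auto simp: U)
        then have "g a \<notin> K" using that inj by (force simp: inv_into_f_f)
        with that have "g a \<in> ?f C" by blast
        then show ?thesis using a that(3) inj by (auto simp: U inj_on_def)
      qed
      from this[of _ A C] this[of _ C A] AC have "A - ?K = C - ?K" by blast
      moreover have "y \<in> A" "y \<in> C" "C \<subseteq> Field r"
        using AC by (simp_all add: sets_with_min_eq[OF wo_rel_axioms])
      ultimately show ?thesis by (auto simp: mem_ball_exp_point_ideal_iff)
    qed
    ultimately show ?case
      by (intro bexI[of _ ?K]) (auto simp: mem_ball_cantor_iff)
  qed (auto simp: mem_ball_cantor_iff)
qed

text \<open>One minimum is traded for the other: the part of \<open>A\<close> inside the two initial
  segments is replaced by the new minimum. What remains lies above \<open>y\<close> and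
  \<open>z\<close>, and old and new set both meet the radius and agree off it.\<close>

lemma sets_with_min_close:
  assumes r: "Cinfinite r" and y: "y \<in> Field r" and z: "z \<in> Field r"
  shows "close_sets (hyperballean_ne (point_ideal_ballean (Field r) (small_subsets r)))
    (sets_with_min r y) (sets_with_min r z)"
proof -
  interpret wo_rel r using r by (rule Cinfinite_wo_rel)
  let ?E = "hyperballean_ne (point_ideal_ballean (Field r) (small_subsets r))"
  let ?K = "under y \<union> under z"
  have yz: "y \<in> ?K" "z \<in> ?K" using y z REFL by (auto simp: under_def refl_on_def)
  have K: "?K \<in> small_subsets r"
    using small_subset_Un[OF r] small_subset_under[OF r] y z by blast
  have above: "(w, a) \<in> r" if "w \<in> {y, z}" "a \<in> Field r" "a \<notin> ?K" for a w
    using that y z TOTALS by (auto simp: under_def)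
  have sub: "sets_with_min r w \<subseteq> ball_set ?E (sets_with_min r v) ?K"
    if vw: "v \<in> {y, z}" "w \<in> {y, z}" for v w
  proof
    fix A assume A: "A \<in> sets_with_min r w"
    let ?C = "insert v (A - ?K)"
    have v: "v \<in> Field r" "v \<in> ?K" and w: "w \<in> ?K" using vw y z yz by auto
    have "?C \<in> sets_with_min r v"
      using A v above[OF vw(1)] REFL
      by (auto simp: sets_with_min_eq[OF wo_rel_axioms] refl_on_def)
    moreover have "A \<in> ball ?E ?C ?K"
    proof -
      have "w \<in> A" "A \<subseteq> Field r" using A by (auto simp: sets_with_min_eq[OF wo_rel_axioms])
      then show ?thesis
        using v w by (simp add: hyperballean_ne_def mem_ball_exp_point_ideal_iff) blast
    qed
    ultimately show "A \<in> ball_set ?E (sets_with_min r v) ?K"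
      by (auto simp: ball_set_def)
  qed
  have supp: "sets_with_min r w \<subseteq> support ?E" for w
    by (auto simp: hyperballean_ne_def sets_with_min_def)
  have "radii ?E = small_subsets r" by (simp add: hyperballean_ne_def)
  \<comment> \<open>Closeness lives in the hyperballean of \<open>?E\<close>, whose balls ask for
    inclusion both ways; centring at the family of \<open>z\<close> puts both families in one
    component.\<close>
  moreover have "sets_with_min r w \<in> ball (hyperballean ?E) (sets_with_min r z) ?K"
    if "w \<in> {y, z}" for w
    using sub[of w z] sub[of z w] that supp[of w] by (simp add: hyperballean_def)
  ultimately have "sets_with_min r w \<in> component (hyperballean ?E) (sets_with_min r z)"
    if "w \<in> {y, z}" for w
    using that K unfolding component_def hyperballean_simps by blast
  then show ?thesis
    unfolding close_sets_def using supp[of z] by (intro bexI[of _ "sets_with_min r z"]) auto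
qed

lemma disjoint_sets_with_min: "disjoint_family_on (sets_with_min r) (Field r)"
  by (auto simp: disjoint_family_on_def sets_with_min_def)

lemma Union_sets_with_min:
  assumes "wo_rel r"
  shows "(\<Union>y\<in>Field r. sets_with_min r y) = Pow (Field r) - {{}}"
  using wo_rel.minim_inField[OF assms] by (auto simp: sets_with_min_def)

text \<open>Each family contains the singleton of its minimum, so disjointness makes
  \<open>sets_with_min r\<close> injective on the field.\<close>

lemma card_sets_with_min:
  assumes r: "Cinfinite r"
  shows "|sets_with_min r ` Field r| =o r"
proof -
  interpret wo_rel r using r by (rule Cinfinite_wo_rel)
  have "{y} \<in> sets_with_min r y" if "y \<in> Field r" for y
    using that REFL by (auto simp: sets_with_min_eq[OF wo_rel_axioms] refl_on_def)
  then have "inj_on (sets_with_min r) (Field r)"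
    using disjoint_sets_with_min[of r] unfolding disjoint_family_on_def inj_on_def by blast
  then have "bij_betw (sets_with_min r) (Field r) (sets_with_min r ` Field r)"
    by (rule inj_on_imp_bij_betw)
  then have "|sets_with_min r ` Field r| =o |Field r|"
    using card_of_ordIso ordIso_symmetric by blast
  moreover have "|Field r| =o r" using r card_of_Field_ordIso by blast
  ultimately show ?thesis by (rule ordIso_transitive)
qed

section \<open>Embedding into the hyperballean of the ary ballean\<close>

text \<open>Regularity serves twice: forwards it bounds the minima of sets meeting a small radius,
  so their second parts fit into one small segment; backwards it gives a point beyond all indices
  coded in the radius.\<close>

lemma exp_point_ideal_embeds_exp_ary:
  assumes r: "Cinfinite r" and reg: "regularCard r"
  shows "\<exists>f. asymorphic_embedding
    (hyperballean (point_ideal_ballean (Field r) (small_subsets r)))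
    (hyperballean (ary_ballean (Field r) (small_subsets r))) f"
proof -
  interpret wo_rel r using r by (rule Cinfinite_wo_rel)
  let ?F = "Field r" and ?I = "small_subsets r"
  let ?B = "hyperballean (point_ideal_ballean ?F ?I)" and ?C = "hyperballean (ary_ballean ?F ?I)"
  \<comment> \<open>Infinity of the field lets \<open>h\<close> code two disjoint copies of it
    inside itself, tagged by \<open>Inl\<close> and \<open>Inr\<close>.\<close>
  have "|?F <+> ?F| =o |?F|"
    using card_of_Plus_infinite1[of ?F ?F] r card_of_refl ordIso_imp_ordLeq
    by (auto simp: cinfinite_def)
  then obtain h where h: "bij_betw h (?F <+> ?F) ?F" by (auto simp: card_of_ordIso[symmetric])
  then have inj: "inj_on h (?F <+> ?F)" and im: "h ` (?F <+> ?F) = ?F"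
    by (auto simp: bij_betw_def)
  have hF: "h (Inl a) \<in> ?F" "h (Inr a) \<in> ?F" if "a \<in> ?F" for a
    using that im by blast+
  \<comment> \<open>\<open>minim {}\<close> carries no information. The default sends the empty set,
    isolated in both hyperballeans, to itself.\<close>
  define S where "S A = (if A = {} then {} else underS (minim A))" for A
  define f where "f A = h ` (A <+> S A)" for A
  have SF: "S A \<subseteq> ?F" for A using Order_Relation.underS_Field[of r "minim A"] by (simp add: S_def)
  have fF: "f A \<subseteq> ?F" if "A \<subseteq> ?F" for A using that SF[of A] im by (auto simp: f_def)
  have f_empty: "f A = {} \<longleftrightarrow> A = {}" for A by (auto simp: f_def S_def)
  have f_Inl: "h (Inl a) \<in> f A \<longleftrightarrow> a \<in> A" and f_Inr: "h (Inr a) \<in> f A \<longleftrightarrow> a \<in> S A"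
    if "a \<in> ?F" "A \<subseteq> ?F" for a A
  proof -
    have "A <+> S A \<subseteq> ?F <+> ?F" using that SF[of A] by blast
    then show "h (Inl a) \<in> f A \<longleftrightarrow> a \<in> A" "h (Inr a) \<in> f A \<longleftrightarrow> a \<in> S A"
      using that inj_on_image_mem_iff[OF inj, of _ "A <+> S A"] unfolding f_def by blast+
  qed
  have injf: "inj_on f (Pow ?F)"
    by (rule inj_onI) (use f_Inl in blast)
  \<comment> \<open>Turns the second part of \<open>f A\<close> into the meeting test that governs
    point ideal balls of radius \<open>under a\<close>.\<close>
  have mem_S: "a \<in> S A \<longleftrightarrow> A \<inter> under a = {}" if "a \<in> ?F" "A \<subseteq> ?F" "A \<noteq> {}" for a A
  proof -
    have m: "minim A \<in> A" "minim A \<in> ?F" "\<And>b. b \<in> A \<Longrightarrow> (minim A, b) \<in> r"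
      using minim_in[OF that(2,3)] minim_least[OF that(2)] that(2) by auto
    have "(a, minim A) \<in> r \<and> a \<noteq> minim A \<longleftrightarrow> (minim A, a) \<notin> r"
      using that(1) m(2) TOTALS ANTISYM REFL by (auto simp: antisym_def refl_on_def)
    also have "\<dots> \<longleftrightarrow> (\<forall>b\<in>A. (b, a) \<notin> r)"
      using m TRANS by (meson transD)
    finally show ?thesis using that(3) by (auto simp: S_def underS_def under_def)
  qed
  have "asymorphism ?B (subballean ?C (f ` support ?B)) f"
  proof (rule asymorphismI, goal_cases)
    case 1
    show ?case using injf by (simp add: inj_on_imp_bij_betw)
  next
    case (4 K)
    then have K: "K \<in> ?I" by simp
    from small_subset_bounded[OF r reg K] obtain a where a: "a \<in> ?F" "K \<subseteq> underS a" .
    \<comment> \<open>The first half copies \<open>K\<close>, outside which \<open>A\<close> and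
      \<open>C\<close> agree; the second half swallows the whole segment that contains both
      \<open>S A\<close> and \<open>S C\<close>.\<close>
    let ?L = "(\<lambda>x. h (Inl x)) ` K \<union> (\<lambda>x. h (Inr x)) ` underS a"
    have KF: "K \<subseteq> ?F" using K by (simp add: small_subsets_def)
    have "underS a \<in> ?I"
      by (rule small_subset_mono[OF r small_subset_under[OF r a(1)] underS_subset_under])
    then have "(\<lambda>x. h (Inr x)) ` underS a \<in> ?I"
      by (rule small_subset_image) (use hF in \<open>auto simp: underS_def FieldI1\<close>)
    moreover have "(\<lambda>x. h (Inl x)) ` K \<in> ?I"
      by (rule small_subset_image[OF K]) (use hF KF in auto)
    ultimately have L: "?L \<in> ?I" using small_subset_Un[OF r] by blast
    have *: "f A - ?L \<subseteq> f C"
      if AC: "A \<subseteq> ?F" "A \<inter> K \<noteq> {}" "A - K = C - K" for A C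
    proof -
      \<comment> \<open>A common point of \<open>A\<close> and \<open>K\<close> lies below
        \<open>a\<close>, hence so do the minimum of \<open>A\<close> and all of
        \<open>S A\<close>.\<close>
      have "S A \<subseteq> underS a"
      proof
        fix b assume b: "b \<in> S A"
        from AC(2) obtain k where k: "k \<in> A" "k \<in> K" by blast
        have bF: "b \<in> ?F" using b SF by blast
        have "(k, b) \<notin> r" using mem_S[OF bF AC(1)] b k(1) by (auto simp: under_def)
        moreover have "(k, a) \<in> r" using a(2) k(2) by (auto simp: underS_def)
        ultimately have "(a, b) \<notin> r" using TRANS by (meson transD)
        then show "b \<in> underS a"
          using TOTALS REFL bF a(1) by (auto simp: underS_def refl_on_def)
      qed
      with AC(3) show ?thesis by (auto simp: f_def)
    qed
    have "f C \<in> ball ?C (f A) ?L"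
      if "A \<subseteq> ?F" "C \<subseteq> ?F" "C \<in> ball ?B A K" for A C
    proof (cases "A = C")
      case False
      with that(3) have meet: "A \<inter> K \<noteq> {}" "C \<inter> K \<noteq> {}" "A - K = C - K"
        unfolding mem_ball_exp_point_ideal_iff by blast+
      have "f A - ?L = f C - ?L"
        using *[OF that(1) meet(1,3)] *[OF that(2) meet(2) meet(3)[symmetric]] by blast
      moreover have "A \<noteq> {}" "C \<noteq> {}" using meet by auto
      ultimately show ?thesis
        using fF[OF that(2)] by (simp add: mem_ball_exp_ary_iff f_empty)
    qed (use fF that in \<open>simp add: mem_ball_exp_ary_iff\<close>)
    with L show ?case by (intro bexI[of _ ?L]) auto
  next
    case (5 K)
    then have K: "K \<in> ?I" by simp
    \<comment> \<open>\<open>p\<close> forgets the half and returns the index, so the indices coded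
      in \<open>K\<close> form a small, hence bounded, set.\<close>
    define p where "p u = (case inv_into (?F <+> ?F) h u of Inl a \<Rightarrow> a | Inr a \<Rightarrow> a)" for u
    have p: "p (h (Inl b)) = b" "p (h (Inr b)) = b" if "b \<in> ?F" for b
      using that inj by (simp_all add: p_def inv_into_f_f InlI InrI)
    have "p ` K \<subseteq> ?F"
    proof
      fix b assume "b \<in> p ` K"
      then obtain v where v: "v \<in> K" "b = p v" by blast
      then have "v \<in> h ` (?F <+> ?F)" using K by (auto simp: im small_subsets_def)
      with v(2) obtain u where "u \<in> ?F <+> ?F" "b = p (h u)" by blast
      with p show "b \<in> ?F" by auto
    qed
    with K have "p ` K \<in> ?I" by (rule small_subset_image)
    from small_subset_bounded[OF r reg this] obtain a where a: "a \<in> ?F" "p ` K \<subseteq> underS a" .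
    have notK: "h (Inl b) \<notin> K" "h (Inr b) \<notin> K" if "b \<in> ?F" "b \<notin> underS a" for b
      using p[OF that(1)] that(2) a(2) by (metis image_subset_iff)+
    have "C \<in> ball ?B A (under a)"
      if AC: "A \<subseteq> ?F" "C \<subseteq> ?F" "A = {} \<longleftrightarrow> C = {}" "f A - K = f C - K" for A C
    proof (cases "A = {}")
      case False
      \<comment> \<open>\<open>a\<close> is not strictly below itself, so its code escapes
        \<open>K\<close>. That one code decides whether each set meets the closed segment
        \<open>under a\<close>, which is why this segment is the radius.\<close>
      have "h (Inr a) \<in> f A \<longleftrightarrow> h (Inr a) \<in> f C"
        using notK(2)[OF a(1)] AC(4) by (auto simp: underS_notIn)
      then have meet: "A \<inter> under a = {} \<longleftrightarrow> C \<inter> under a = {}"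
        using AC a(1) False by (simp add: f_Inr mem_S)
      have "b \<in> A \<longleftrightarrow> b \<in> C" if b: "b \<in> ?F" "b \<notin> under a" for b
      proof -
        have "h (Inl b) \<notin> K" using notK(1)[OF b(1)] b(2) by (auto simp: underS_def under_def)
        then have "h (Inl b) \<in> f A \<longleftrightarrow> h (Inl b) \<in> f C" using AC(4) by blast
        then show ?thesis using AC b by (simp add: f_Inl)
      qed
      then have "A - under a = C - under a" using AC by blast
      with meet AC(2) show ?thesis by (auto simp: mem_ball_exp_point_ideal_iff)
    qed (use AC in \<open>simp add: mem_ball_exp_point_ideal_iff\<close>)
    with small_subset_under[OF r a(1)] show ?case
      by (intro bexI[of _ "under a"]) (auto simp: mem_ball_exp_ary_iff f_empty)
  qed (auto simp: mem_ball_exp_point_ideal_iff)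
  moreover have "f ` support ?B \<subseteq> support ?C" using fF by auto
  ultimately show ?thesis unfolding asymorphic_embedding_def by blast
qed

theorem theorem3p5:
  fixes r :: "'a rel" and x :: 'a
  assumes "Cinfinite r" and "x \<in> Field r"
  shows
    "(asymorphic
        (subballean (hyperballean (point_ideal_ballean (Field r) (small_subsets r))) (sets_with_min r x))
        (cantor_ballean (Field r) (small_subsets r)) \<and>
      support (hyperballean_ne (point_ideal_ballean (Field r) (small_subsets r))) =
        (\<Union>y\<in>Field r. sets_with_min r y) \<and>
      disjoint_family_on (sets_with_min r) (Field r) \<and>
      |sets_with_min r ` Field r| =o r \<and>
      (\<forall>y\<in>Field r. asymorphic
        (subballean (hyperballean_ne (point_ideal_ballean (Field r) (small_subsets r))) (sets_with_min r y))
        (cantor_ballean (Field r) (small_subsets r))) \<and>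
      (\<forall>y\<in>Field r. \<forall>z\<in>Field r.
        close_sets (hyperballean_ne (point_ideal_ballean (Field r) (small_subsets r)))
          (sets_with_min r y) (sets_with_min r z))) \<and>
     (regularCard r \<longrightarrow>
       (\<exists>f. asymorphic_embedding
         (hyperballean (point_ideal_ballean (Field r) (small_subsets r)))
         (hyperballean (ary_ballean (Field r) (small_subsets r))) f))"
proof -
  \<comment> \<open>All these sets being nonempty, restricting through the nonempty part first
    yields the same subballean, so the copies carry over.\<close>
  have "sets_with_min r y \<subseteq> Pow (Field r) - {{}}" for y
    by (auto simp: sets_with_min_def)
  then have "asymorphic
      (subballean (hyperballean_ne (point_ideal_ballean (Field r) (small_subsets r))) (sets_with_min r y))
      (cantor_ballean (Field r) (small_subsets r))" if "y \<in> Field r" for y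
    using asymorphic_sets_with_min[OF assms(1) that]
    by (simp add: hyperballean_ne_def subballean_subballean)
  moreover have "support (hyperballean_ne (point_ideal_ballean (Field r) (small_subsets r))) =
      (\<Union>y\<in>Field r. sets_with_min r y)"
    using assms(1) by (simp add: hyperballean_ne_def Union_sets_with_min Cinfinite_wo_rel)
  ultimately show ?thesis
    using assms asymorphic_sets_with_min[OF assms] disjoint_sets_with_min[of r]
      card_sets_with_min[OF assms(1)] sets_with_min_close[OF assms(1)]
      exp_point_ideal_embeds_exp_ary[OF assms(1)] by simp
qed

end
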